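(* Let $(\Omega,\mathcal F,\mu)$ be a finite probability space, $I,J$ finite sets, $(\mathcal F_i)_{i\in I}$ an independent family of sub-sigma-algebras of $\mathcal F$, and for $i\in I$, $j\in J$ let $f_{i,j}$ be an $\mathcal F_i$-measurable real function on $\Omega$ and $w_{i,j}$ a $[0,1]$-valued function on $\Omega$. Let $1\le p<\infty$ and $0\le\varepsilon<\kappa\le1$. Then $$\mathbb E\Big(\sum_{i,j}\big|(w_{i,j}\vee\varepsilon)f_{i,j}\big|^p\Big)^{\frac1p}\ \ge\ C_{p,\kappa}\,\Big\|\bigsqcup_i\big(\mathbf 1_{\{\mathbb E_i(w_{i,j}\vee\varepsilon)\ge\kappa\}}f_{i,j}\big)_{j\in J}\Big\|_{(L^1+L^p)\left(\bigsqcup_i(\Omega,\mathcal F_i,\mu),\,\ell^p(J)\right)},$$ where $C_{p,\kappa}=\kappa^p2^{-1/p'}$ and $\frac1{p'}=1-\frac1p$. Moreover, if all $w_{i,j}$ are $\{0,1\}$-valued, the inequality holds with the constant $(\kappa-\varepsilon)^{2-\frac1p}\,2^{-1/p'}$ in place of $C_{p,\kappa}$.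
   Context: $\mathbb E_i=\mathbb E(\cdot\mid\mathcal F_i)$; $a\vee b=\max(a,b)$; $\mathbb E(\sum\cdots)^{1/p}$ is the expectation of the $p$-th root. $\bigsqcup_i(\Omega,\mathcal F_i,\mu)$ is the disjoint union of the measure spaces $(\Omega,\mathcal F_i,\mu)$, with measure equal to the sum of the measures of the pieces; a family $(F_i)_{i\in I}$ with $F_i$ an $\mathcal F_i$-measurable $\ell^p(J)$-valued function on $\Omega$ defines a function $\bigsqcup_iF_i$ on it. Explicitly, $$\Big\|\bigsqcup_iF_i\Big\|_{(L^1+L^p)(\bigsqcup_i(\Omega,\mathcal F_i,\mu),\ell^p(J))}=\inf\Big\{\sum_i\mathbb E\|G_i\|_{\ell^p(J)}+\Big(\sum_i\mathbb E\|H_i\|_{\ell^p(J)}^p\Big)^{1/p}\Big\},$$ the infimum being over $F_i=G_i+H_i$ with $G_i,H_i$ $\mathcal F_i$-measurable and $\ell^p(J)$-valued. *)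

theory Defs
  imports "HOL-Probability.Probability"
begin

definition lp_norm :: "'j set \<Rightarrow> real \<Rightarrow> ('j \<Rightarrow> real) \<Rightarrow> real" where
  "lp_norm J p a = (\<Sum>j\<in>J. \<bar>a j\<bar> powr p) powr (1 / p)"

definition lp_measurable :: "'i set \<Rightarrow> 'j set \<Rightarrow> ('i \<Rightarrow> 'a measure) \<Rightarrow> ('i \<Rightarrow> 'a \<Rightarrow> 'j \<Rightarrow> real) \<Rightarrow> bool" where
  "lp_measurable I J \<F> G \<longleftrightarrow> (\<forall>i\<in>I. \<forall>j\<in>J. (\<lambda>x. G i x j) \<in> borel_measurable (\<F> i))"

text \<open>
  The norm of the function defined by the family \<open>\<Phi>\<close> in \<open>L\<^sup>1 + L\<^sup>p\<close>, with values in \<open>\<ell>\<^sup>p(J)\<close>, of the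
  disjoint union over \<open>i \<in> I\<close> of the spaces \<open>(\<Omega>, \<F> i, \<mu>)\<close>. An integral over the disjoint
  union is the sum over \<open>i\<close> of the integrals over the pieces, and the integral over
  \<open>(\<Omega>, \<F> i, \<mu>)\<close> of an \<open>\<F> i\<close>-measurable function is its integral with respect to \<open>M\<close>.
  The two integrability conditions say that \<open>G\<close> is in \<open>L\<^sup>1\<close> and \<open>H\<close> is in \<open>L\<^sup>p\<close>; without them
  the Bochner integral of a non-integrable function would count as \<open>0\<close>. They hold
  automatically for measurable functions when \<open>space M\<close> and \<open>J\<close> are finite and \<open>M\<close> is a finite measure.
\<close>

definition L1_plus_Lp_norm ::
  "'a measure \<Rightarrow> 'i set \<Rightarrow> 'j set \<Rightarrow> ('i \<Rightarrow> 'a measure) \<Rightarrow> real \<Rightarrow> ('i \<Rightarrow> 'a \<Rightarrow> 'j \<Rightarrow> real) \<Rightarrow> real" where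
  "L1_plus_Lp_norm M I J \<F> p \<Phi> =
     Inf {(\<Sum>i\<in>I. \<integral>x. lp_norm J p (G i x) \<partial>M)
            + (\<Sum>i\<in>I. \<integral>x. lp_norm J p (H i x) powr p \<partial>M) powr (1 / p) | G H.
          lp_measurable I J \<F> G \<and> lp_measurable I J \<F> H \<and>
          (\<forall>i\<in>I. integrable M (\<lambda>x. lp_norm J p (G i x))) \<and>
          (\<forall>i\<in>I. integrable M (\<lambda>x. lp_norm J p (H i x) powr p)) \<and>
          (\<forall>i\<in>I. \<forall>x\<in>space M. \<forall>j\<in>J. \<Phi> i x j = G i x j + H i x j)}"

text \<open>
  The conditional expectation is determined only up to a null set; this choice does not affect
  the norm above.
\<close>

definition truncated_family ::
  "'a measure \<Rightarrow> ('i \<Rightarrow> 'a measure) \<Rightarrow> real \<Rightarrow> real \<Rightarrow> ('i \<Rightarrow> 'j \<Rightarrow> 'a \<Rightarrow> real) \<Rightarrow>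
     ('i \<Rightarrow> 'j \<Rightarrow> 'a \<Rightarrow> real) \<Rightarrow> 'i \<Rightarrow> 'a \<Rightarrow> 'j \<Rightarrow> real" where
  "truncated_family M \<F> \<epsilon> \<kappa> w f i x j =
     indicator {y \<in> space M. real_cond_exp M (\<F> i) (\<lambda>z. max (w i j z) \<epsilon>) y \<ge> \<kappa>} x * f i j x"

end

theory Submission
  imports Defs
begin

text \<open>
  Write \<open>u\<^sub>i\<^sub>j = max w\<^sub>i\<^sub>j \<epsilon>\<close>, let \<open>g\<close> be the truncated family, \<open>X\<^sub>i\<close> the \<open>\<ell>\<^sup>p(J)\<close> norm of \<open>g\<^sub>i\<close>, and
  \<open>\<theta> = 1 - 1/p\<close>. Both inequalities follow from the single bound with the constant
  \<open>\<kappa> powr (1 + \<theta>) * 2 powr (- \<theta>)\<close>, valid for all weights with values in \<open>[0, 1]\<close>: this constant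
  dominates the two others, because \<open>\<kappa> \<le> 1\<close>, \<open>1 + \<theta> = 2 - 1/p \<le> p\<close> and \<open>\<kappa> - \<epsilon> \<le> \<kappa>\<close>.

  The proof is by duality. The dual unit ball of \<open>L\<^sup>1 + L\<^sup>p\<close> is the intersection of those of
  \<open>L\<^sup>\<infinity>\<close> and \<open>L\<^sup>p\<^sup>'\<close>, and a functional that norms \<open>g\<close> can be written down. The best decomposition
  of \<open>g\<close> cuts its norm at some level \<open>\<tau>\<close>: with \<open>c\<^sub>i = 1 / max \<tau> X\<^sub>i\<close>, the part \<open>\<tau> c\<^sub>i g\<^sub>i\<close>
  goes to \<open>L\<^sup>p\<close> and the rest to \<open>L\<^sup>1\<close>. The level is chosen such that the \<open>Z\<^sub>i = (c\<^sub>i X\<^sub>i)\<^sup>p\<close> have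
  \<open>\<Sum>\<^sub>i E Z\<^sub>i = 1\<close>, or \<open>\<tau> = 0\<close> when the supports of the \<open>X\<^sub>i\<close> have total measure at most \<open>1\<close>
  (\<open>exists_truncation_level\<close>). The norming functional is \<open>\<bar>c\<^sub>i g\<^sub>i\<^sub>j\<bar>\<^sup>p\<^sup>-\<^sup>1\<close> with the sign of \<open>g\<^sub>i\<^sub>j\<close>; with
  \<open>d\<^sub>i\<^sub>j = \<bar>g\<^sub>i\<^sub>j\<bar> \<bar>c\<^sub>i g\<^sub>i\<^sub>j\<bar>\<^sup>p\<^sup>-\<^sup>1\<close>, the norm is at most \<open>\<Sum>\<^sub>i\<^sub>j E d\<^sub>i\<^sub>j\<close> (\<open>L1_plus_Lp_norm_le\<close>).

  On \<open>\<Omega>\<close> itself the functional is not normalised pointwise, but dividing it by \<open>S\<^sup>\<theta>\<close> with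
  \<open>S = \<Sum>\<^sub>i Z\<^sub>i\<close> makes it so, and Hoelder's inequality bounds the left side of the theorem from
  below by \<open>\<Sum>\<^sub>i\<^sub>j E (d\<^sub>i\<^sub>j u\<^sub>i\<^sub>j S\<^sup>-\<^sup>\<theta>)\<close>. Here independence enters: seen from \<open>\<F>\<^sub>i\<close>, the own
  term \<open>Z\<^sub>i\<close> is at most \<open>1\<close> and the other terms have total mean at most \<open>1\<close>, so that
  \<open>E (d\<^sub>i\<^sub>j S) \<le> 2 E d\<^sub>i\<^sub>j\<close> (\<open>integral_mult_indep_sum_le\<close>). As \<open>d\<^sub>i\<^sub>j\<close> lives where the
  conditional mean of \<open>u\<^sub>i\<^sub>j\<close> is at least \<open>\<kappa>\<close>, convexity of \<open>s \<mapsto> s\<^sup>-\<^sup>\<theta>\<close> turns this into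
  \<open>E (d\<^sub>i\<^sub>j u\<^sub>i\<^sub>j S\<^sup>-\<^sup>\<theta>) \<ge> \<kappa>\<^sup>1\<^sup>+\<^sup>\<theta> 2\<^sup>-\<^sup>\<theta> E d\<^sub>i\<^sub>j\<close> (\<open>weighted_neg_moment_ge\<close>), and summing over
  \<open>i\<close> and \<open>j\<close> gives the claim.
\<close>

section \<open>Two elementary inequalities\<close>

text \<open>
  The tangent at \<open>t\<close> of the convex function \<open>s \<mapsto> s powr (- \<theta>)\<close> lies below its graph. It
  replaces Jensen's inequality for conditional means by two linear estimates.
\<close>

lemma neg_powr_ge_tangent:
  fixes s t \<theta> :: real
  assumes "0 < s" "0 < t" "0 \<le> \<theta>"
  shows "t powr (- \<theta>) * (1 + \<theta> - \<theta> * s / t) \<le> s powr (- \<theta>)"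
proof -
  have "1 + \<theta> - \<theta> * s / t = 1 - \<theta> * (s / t - 1)" by (simp add: algebra_simps)
  also have "\<dots> \<le> 1 - \<theta> * ln (s / t)"
    using assms ln_le_minus_one[of "s / t"] by (simp add: mult_left_mono)
  also have "\<dots> \<le> exp (- \<theta> * ln (s / t))"
    using exp_ge_add_one_self[of "- \<theta> * ln (s / t)"] by simp
  also have "\<dots> = (s / t) powr (- \<theta>)" using assms by (simp add: powr_def)
  finally have "t powr (- \<theta>) * (1 + \<theta> - \<theta> * s / t) \<le> t powr (- \<theta>) * (s / t) powr (- \<theta>)"
    by (simp add: mult_left_mono)
  also have "\<dots> = (t * (s / t)) powr (- \<theta>)" using assms by (subst powr_mult) auto
  finally show ?thesis using assms by simp
qed

text \<open>
  Hoelder's inequality, with the second factor written as \<open>b powr (p - 1)\<close> so that \<open>p = 1\<close> is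
  included: then that factor is the indicator of \<open>b \<noteq> 0\<close>, because \<open>0 powr 0 = 0\<close>.
\<close>

lemma Holder_sum_powr:
  fixes a b :: "'k \<Rightarrow> real" and p :: real
  assumes fin: "finite K" and p: "1 \<le> p"
    and a: "\<And>k. k \<in> K \<Longrightarrow> 0 \<le> a k" and b: "\<And>k. k \<in> K \<Longrightarrow> 0 \<le> b k"
  shows "(\<Sum>k\<in>K. a k * b k powr (p - 1))
           \<le> (\<Sum>k\<in>K. a k powr p) powr (1 / p) * (\<Sum>k\<in>K. b k powr p) powr (1 - 1 / p)"
proof -
  define A where "A = (\<Sum>k\<in>K. a k powr p)"
  define B where "B = (\<Sum>k\<in>K. b k powr p)"
  have A0: "0 \<le> A" and B0: "0 \<le> B" unfolding A_def B_def by (auto intro: sum_nonneg)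
  show ?thesis
  proof (cases "A = 0 \<or> B = 0")
    case True
    then have "a k * b k powr (p - 1) = 0" if "k \<in> K" for k
      using that fin p by (auto simp: A_def B_def sum_nonneg_eq_0_iff)
    then have "(\<Sum>k\<in>K. a k * b k powr (p - 1)) = 0" by (intro sum.neutral ballI)
    then show ?thesis using A0 B0 by (simp flip: A_def B_def)
  next
    case False
    with A0 B0 have AB: "0 < A" "0 < B" by auto
    define N where "N = A powr (1 / p) * B powr (1 - 1 / p)"
    have N0: "0 < N" using AB by (simp add: N_def)
    have term_le: "a k * b k powr (p - 1) \<le> N * (1 / p * (a k powr p / A) + (1 - 1 / p) * (b k powr p / B))"
      if k: "k \<in> K" for k
    proof (cases "a k = 0 \<or> b k = 0")
      case True
      then have "a k * b k powr (p - 1) = 0" by auto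
      also have "0 \<le> N * (1 / p * (a k powr p / A) + (1 - 1 / p) * (b k powr p / B))"
        using AB N0 p by simp
      finally show ?thesis .
    next
      case False
      then have pos: "0 < a k" "0 < b k" using a[OF k] b[OF k] by auto
      have "(a k powr p / A) powr (1 / p) * (b k powr p / B) powr (1 - 1 / p)
              \<le> 1 / p * (a k powr p / A) + (1 - 1 / p) * (b k powr p / B)"
        using p AB pos by (intro Youngs_inequality_0) (auto simp: field_simps)
      moreover have "(a k powr p / A) powr (1 / p) * (b k powr p / B) powr (1 - 1 / p)
              = a k * b k powr (p - 1) / N"
      proof -
        have "p * (1 - 1 / p) = p - 1" using p by (simp add: field_simps)
        then show ?thesis using p AB pos
          by (simp add: powr_divide powr_powr N_def)
      qed
      ultimately show ?thesis using N0 by (simp add: pos_divide_le_eq mult.commute)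
    qed
    have "(\<Sum>k\<in>K. a k * b k powr (p - 1))
        \<le> (\<Sum>k\<in>K. N * (1 / p * (a k powr p / A) + (1 - 1 / p) * (b k powr p / B)))"
      by (intro sum_mono term_le)
    also have "\<dots> = N * (1 / p * (A / A) + (1 - 1 / p) * (B / B))"
      unfolding A_def B_def
      by (simp add: sum_distrib_left[symmetric] sum.distrib sum_divide_distrib[symmetric])
    also have "\<dots> = N" using AB by simp
    finally show ?thesis by (simp add: N_def A_def B_def)
  qed
qed

section \<open>Independent sigma-algebras and weighted means\<close>

lemma finite_space_integrable:
  fixes h :: "'a \<Rightarrow> real"
  assumes "finite_measure M" and "finite (space M)" and "h \<in> borel_measurable M"
  shows "integrable M h"
proof -
  interpret finite_measure M by fact
  show ?thesis
  proof (rule integrable_const_bound[where B = "\<Sum>y\<in>space M. norm (h y)"])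
    show "AE x in M. norm (h x) \<le> (\<Sum>y\<in>space M. norm (h y))"
      using assms(2) by (intro AE_I2 member_le_sum) auto
  qed fact
qed

lemma (in prob_space) indep_set_integral_mult:
  fixes g h :: "'a \<Rightarrow> real"
  assumes indep: "indep_set (sets F) (sets G)"
    and sub: "subalgebra M F" "subalgebra M G"
    and meas: "g \<in> borel_measurable F" "h \<in> borel_measurable G"
    and int: "integrable M g" "integrable M h"
  shows "(\<integral>x. g x * h x \<partial>M) = (\<integral>x. g x \<partial>M) * (\<integral>x. h x \<partial>M)"
proof (rule indep_var_lebesgue_integral[OF _ int])
  have gen: "sigma_sets (space M) {k -` A \<inter> space M | A. A \<in> sets borel} \<subseteq> sets H"
    if "subalgebra M H" "k \<in> borel_measurable H" for H :: "'a measure" and k :: "'a \<Rightarrow> real"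
  proof -
    have sp: "space H = space M" using that(1) by (simp add: subalgebra_def)
    show ?thesis unfolding sp[symmetric]
      using that(2) by (intro sets.sigma_sets_subset) (auto dest: measurable_sets)
  qed
  show "indep_var borel g borel h"
    unfolding indep_var_eq
    using indep gen[OF sub(1) meas(1)] gen[OF sub(2) meas(2)]
      measurable_from_subalg[OF sub(1) meas(1)] measurable_from_subalg[OF sub(2) meas(2)]
    unfolding indep_sets2_eq by blast
qed

text \<open>
  The factor \<open>2\<close> is the bound \<open>Z i \<le> 1\<close> for the one term that need not be independent of \<open>d\<close>,
  plus the bound \<open>1\<close> for the mean of the sum of all others.
\<close>

lemma (in prob_space) integral_mult_indep_sum_le:
  fixes Z :: "'i \<Rightarrow> 'a \<Rightarrow> real" and d :: "'a \<Rightarrow> real"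
  assumes fin: "finite (space M)" and finI: "finite I"
    and sub: "\<And>i. i \<in> I \<Longrightarrow> subalgebra M (\<F> i)"
    and indep: "indep_sets (\<lambda>i. sets (\<F> i)) I"
    and Zm: "\<And>i. i \<in> I \<Longrightarrow> Z i \<in> borel_measurable (\<F> i)"
    and Z01: "\<And>i x. i \<in> I \<Longrightarrow> 0 \<le> Z i x \<and> Z i x \<le> 1"
    and Z_le: "(\<Sum>i\<in>I. \<integral>x. Z i x \<partial>M) \<le> 1"
    and i: "i \<in> I" and dm: "d \<in> borel_measurable (\<F> i)" and d0: "\<And>x. 0 \<le> d x"
  shows "(\<integral>x. d x * (\<Sum>k\<in>I. Z k x) \<partial>M) \<le> 2 * (\<integral>x. d x \<partial>M)"
proof -
  note int = finite_space_integrable[OF finite_measure_axioms fin]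
  have ZM: "Z k \<in> borel_measurable M" if "k \<in> I" for k
    using measurable_from_subalg[OF sub[OF that] Zm[OF that]] .
  have dM: "d \<in> borel_measurable M"
    using measurable_from_subalg[OF sub[OF i] dm] .
  define D where "D = (\<integral>x. d x \<partial>M)"
  have D0: "0 \<le> D" unfolding D_def using d0 by (intro Bochner_Integration.integral_nonneg) auto
  have prod: "(\<integral>x. d x * Z k x \<partial>M) = D * (\<integral>x. Z k x \<partial>M)" if k: "k \<in> I - {i}" for k
    unfolding D_def
  proof (rule indep_set_integral_mult)
    have "prob (A \<inter> B) = prob A * prob B" if "A \<in> sets (\<F> i)" "B \<in> sets (\<F> k)" for A B
      using indep_setsD[OF indep, of "{i, k}" "\<lambda>l. if l = i then A else B"] that i k by auto
    then show "indep_set (sets (\<F> i)) (sets (\<F> k))"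
      unfolding indep_sets2_eq using sub i k by (auto simp: subalgebra_def)
  qed (use i k sub dm Zm dM ZM in \<open>auto intro!: int\<close>)
  have "(\<integral>x. d x * (\<Sum>k\<in>I. Z k x) \<partial>M) = (\<Sum>k\<in>I. \<integral>x. d x * Z k x \<partial>M)"
    unfolding sum_distrib_left
    by (rule Bochner_Integration.integral_sum) (use dM ZM in \<open>auto intro!: int\<close>)
  also have "\<dots> = (\<integral>x. d x * Z i x \<partial>M) + D * (\<Sum>k\<in>I - {i}. \<integral>x. Z k x \<partial>M)"
    using i finI by (simp add: sum.remove[of I i] prod sum_distrib_left)
  also have "\<dots> \<le> D + D * 1"
  proof (intro add_mono mult_left_mono D0)
    show "(\<integral>x. d x * Z i x \<partial>M) \<le> D"
      unfolding D_def using d0 Z01[OF i] dM ZM[OF i]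
      by (intro integral_mono int) (auto simp: mult_left_le)
    have "(\<Sum>k\<in>I - {i}. \<integral>x. Z k x \<partial>M) \<le> (\<Sum>k\<in>I. \<integral>x. Z k x \<partial>M)"
      using finI Z01 by (intro sum_mono2) (auto intro!: Bochner_Integration.integral_nonneg)
    then show "(\<Sum>k\<in>I - {i}. \<integral>x. Z k x \<partial>M) \<le> 1" using Z_le by simp
  qed
  finally show ?thesis by (simp add: D_def)
qed

text \<open>
  With \<open>d u\<close> as a density of total mass at least \<open>\<kappa> E d\<close>, the mean of \<open>S\<close> is at most
  \<open>m / \<kappa>\<close>. So by convexity the mean of \<open>S powr (- \<theta>)\<close> is at least \<open>(m / \<kappa>) powr (- \<theta>)\<close>, and
  multiplying by the mass \<open>\<kappa> E d\<close> gives the bound. The weight \<open>u\<close> enters through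
  \<open>u \<le> 1\<close>, which bounds \<open>E (d u S)\<close> by \<open>E (d S)\<close>, and through its conditional mean given \<open>F\<close>,
  which replaces it in \<open>E (d u)\<close> because \<open>d\<close> is measurable with respect to \<open>F\<close>.
\<close>

lemma weighted_neg_moment_ge:
  fixes d u S :: "'a \<Rightarrow> real" and \<kappa> \<theta> m :: real
  assumes "finite_measure_subalgebra M F" and fin: "finite (space M)"
    and d: "d \<in> borel_measurable F" "\<And>x. x \<in> space M \<Longrightarrow> 0 \<le> d x"
    and u: "u \<in> borel_measurable M" "\<And>x. x \<in> space M \<Longrightarrow> 0 \<le> u x \<and> u x \<le> 1"
    and S: "S \<in> borel_measurable M" "\<And>x. x \<in> space M \<Longrightarrow> 0 \<le> S x"
    and supp: "\<And>x. x \<in> space M \<Longrightarrow> 0 < d x \<Longrightarrow> 0 < S x \<and> \<kappa> \<le> real_cond_exp M F u x"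
    and \<kappa>: "0 < \<kappa>" and \<theta>: "0 \<le> \<theta>" and m: "0 < m"
    and dS: "(\<integral>x. d x * S x \<partial>M) \<le> m * (\<integral>x. d x \<partial>M)"
  shows "\<kappa> powr (1 + \<theta>) * m powr (- \<theta>) * (\<integral>x. d x \<partial>M) \<le> (\<integral>x. d x * u x * S x powr (- \<theta>) \<partial>M)"
proof -
  interpret finite_measure_subalgebra M F by fact
  note [measurable] = measurable_from_subalg[OF subalg d(1)] u(1) S(1)
  note int = finite_space_integrable[OF finite_measure_axioms fin]
  \<comment> \<open>The tangent is taken at the largest possible value of the weighted mean of \<open>S\<close>, where the
      two linear estimates below combine to the stated constant.\<close>
  define t where "t = m / \<kappa>"
  have t: "0 < t" using m \<kappa> by (simp add: t_def)
  define D where "D = (\<integral>x. d x \<partial>M)"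
  have duS: "(\<integral>x. d x * u x * S x \<partial>M) \<le> m * D"
  proof -
    have "(\<integral>x. d x * u x * S x \<partial>M) \<le> (\<integral>x. d x * S x \<partial>M)"
    proof (rule integral_mono[OF int int])
      fix x assume x: "x \<in> space M"
      have "(d x * S x) * u x \<le> (d x * S x) * 1"
        using d(2)[OF x] S(2)[OF x] u(2)[OF x] by (intro mult_left_mono) auto
      then show "d x * u x * S x \<le> d x * S x" by (simp add: ac_simps)
    qed measurable
    then show ?thesis using dS by (simp add: D_def)
  qed
  have du: "\<kappa> * D \<le> (\<integral>x. d x * u x \<partial>M)"
  proof -
    have "\<kappa> * D = (\<integral>x. d x * \<kappa> \<partial>M)" by (simp add: D_def)
    also have "\<dots> \<le> (\<integral>x. d x * real_cond_exp M F u x \<partial>M)"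
    proof (rule integral_mono[OF int int])
      fix x assume x: "x \<in> space M"
      show "d x * \<kappa> \<le> d x * real_cond_exp M F u x"
        using d(2)[OF x] supp[OF x] by (cases "d x = 0") (auto intro: mult_left_mono)
    qed measurable
    also have "\<dots> = (\<integral>x. d x * u x \<partial>M)"
      by (rule real_cond_exp_intg(2)[OF int d(1) u(1)]) measurable
    finally show ?thesis .
  qed
  have "\<kappa> powr (1 + \<theta>) * m powr (- \<theta>) * D = t powr (- \<theta>) * \<kappa> * D"
    using \<kappa> m by (simp add: t_def powr_divide powr_add powr_minus field_simps)
  also have "\<dots> = t powr (- \<theta>) * ((1 + \<theta>) * (\<kappa> * D) - \<theta> / t * (m * D))"
    using \<kappa> m by (simp add: t_def algebra_simps)
  also have "\<dots> \<le> t powr (- \<theta>) * ((1 + \<theta>) * (\<integral>x. d x * u x \<partial>M) - \<theta> / t * (\<integral>x. d x * u x * S x \<partial>M))"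
    using \<theta> t du duS by (intro mult_left_mono diff_mono) auto
  also have "\<dots> = (\<integral>x. t powr (- \<theta>) * ((1 + \<theta>) * (d x * u x) - \<theta> / t * (d x * u x * S x)) \<partial>M)"
  proof -
    have "integrable M (\<lambda>x. d x * u x)" "integrable M (\<lambda>x. d x * u x * S x)"
      by (rule int; measurable)+
    then show ?thesis by simp
  qed
  also have "\<dots> \<le> (\<integral>x. d x * u x * S x powr (- \<theta>) \<partial>M)"
  proof (rule integral_mono[OF int int])
    fix x assume x: "x \<in> space M"
    show "t powr (- \<theta>) * ((1 + \<theta>) * (d x * u x) - \<theta> / t * (d x * u x * S x))
            \<le> d x * u x * S x powr (- \<theta>)"
    proof (cases "d x = 0")
      case False
      then have "0 < S x" using supp[OF x] d(2)[OF x] by auto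
      then have "(d x * u x) * (t powr (- \<theta>) * (1 + \<theta> - \<theta> * S x / t)) \<le> (d x * u x) * S x powr (- \<theta>)"
        using neg_powr_ge_tangent[OF _ t \<theta>] d(2)[OF x] u(2)[OF x]
        by (intro mult_left_mono) auto
      then show ?thesis by (simp add: algebra_simps)
    qed simp
  qed measurable
  finally show ?thesis by (simp add: D_def)
qed

section \<open>Truncation as a decomposition\<close>

text \<open>
  The sum decreases continuously from the total measure of the supports at \<open>\<tau> = 0\<close> (by
  \<open>0 / 0 = 0\<close>, the quotient is then the indicator of \<open>X i x \<noteq> 0\<close>) to \<open>0\<close> at infinity, so it takes
  the value \<open>1\<close> unless it starts at or below it.
\<close>

lemma exists_truncation_level:
  fixes X :: "'i \<Rightarrow> 'a \<Rightarrow> real" and p :: real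
  assumes "prob_space M" and "finite I" and p: "1 \<le> p"
    and meas: "\<And>i. i \<in> I \<Longrightarrow> X i \<in> borel_measurable M"
    and X: "\<And>i x. i \<in> I \<Longrightarrow> x \<in> space M \<Longrightarrow> 0 \<le> X i x \<and> X i x \<le> b"
  obtains \<tau> where "0 \<le> \<tau>"
    and "(\<Sum>i\<in>I. \<integral>x. (X i x / max \<tau> (X i x)) powr p \<partial>M) \<le> 1"
    and "\<tau> = 0 \<or> (\<Sum>i\<in>I. \<integral>x. (X i x / max \<tau> (X i x)) powr p \<partial>M) = 1"
proof -
  interpret prob_space M by fact
  define h where "h = (\<lambda>\<tau>. \<Sum>i\<in>I. \<integral>x. (X i x / max \<tau> (X i x)) powr p \<partial>M)"
  have ratio: "0 \<le> X i x / max \<tau> (X i x) \<and> X i x / max \<tau> (X i x) \<le> 1"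
    if "i \<in> I" "x \<in> space M" "0 \<le> \<tau>" for i x \<tau>
    using X[OF that(1,2)] that(3) by (auto simp: divide_le_eq_1)
  have bnd: "(X i x / max \<tau> (X i x)) powr p \<le> 1" if "i \<in> I" "x \<in> space M" "0 \<le> \<tau>" for i x \<tau>
    using ratio[OF that] p by (intro powr_le1) auto
  show thesis
  proof (cases "h 0 \<le> 1")
    case True
    then show ?thesis by (intro that[of 0]) (auto simp: h_def)
  next
    case False
    have cont: "continuous_on {0..} h"
      unfolding h_def
    proof (intro continuous_on_sum continuous_on_sequentiallyI)
      fix i and u :: "nat \<Rightarrow> real" and a :: real
      assume i: "i \<in> I" and u: "\<forall>n. u n \<in> {0..}" and a: "a \<in> {0..}" and lim: "u \<longlonglongrightarrow> a"
      note [measurable] = meas[OF i]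
      show "(\<lambda>n. \<integral>x. (X i x / max (u n) (X i x)) powr p \<partial>M)
              \<longlonglongrightarrow> (\<integral>x. (X i x / max a (X i x)) powr p \<partial>M)"
      proof (rule integral_dominated_convergence[where w = "\<lambda>_. 1"])
        show "AE x in M. (\<lambda>n. (X i x / max (u n) (X i x)) powr p)
                \<longlonglongrightarrow> (X i x / max a (X i x)) powr p"
        proof (rule AE_I2)
          fix x assume x: "x \<in> space M"
          show "(\<lambda>n. (X i x / max (u n) (X i x)) powr p) \<longlonglongrightarrow> (X i x / max a (X i x)) powr p"
          proof (cases "X i x = 0")
            case False
            then have "0 < X i x" using X[OF i x] by auto
            then show ?thesis using lim
              by (intro tendsto_powr tendsto_divide tendsto_max tendsto_const) auto
          qed simp
        qed
        show "AE x in M. norm ((X i x / max (u n) (X i x)) powr p) \<le> 1" for n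
          using bnd[OF i] u by (intro AE_I2) auto
      qed auto
    qed
    \<comment> \<open>At this value of the parameter, each of the \<open>card I\<close> terms is at most \<open>1 / card I\<close>.\<close>
    define T where "T = \<bar>b\<bar> * card I + 1"
    have T: "0 < T" by (simp add: T_def add_nonneg_pos)
    have "h T \<le> (\<Sum>i\<in>I. \<bar>b\<bar> / T)"
      unfolding h_def
    proof (rule sum_mono)
      fix i assume i: "i \<in> I"
      note [measurable] = meas[OF i]
      have "(X i x / max T (X i x)) powr p \<le> \<bar>b\<bar> / T" if x: "x \<in> space M" for x
      proof -
        have "(X i x / max T (X i x)) powr p \<le> (X i x / max T (X i x)) powr 1"
          using ratio[OF i x, of T] T p by (intro powr_mono') auto
        also have "\<dots> = X i x / max T (X i x)" using X[OF i x] T by simp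
        also have "\<dots> \<le> \<bar>b\<bar> / T" using X[OF i x] T by (intro frac_le) auto
        finally show ?thesis .
      qed
      moreover have "integrable M (\<lambda>x. (X i x / max T (X i x)) powr p)"
        using bnd[OF i, of _ T] T by (intro integrable_const_bound[where B = 1] AE_I2) auto
      ultimately have "(\<integral>x. (X i x / max T (X i x)) powr p \<partial>M) \<le> (\<integral>x. \<bar>b\<bar> / T \<partial>M)"
        by (intro integral_mono) auto
      then show "(\<integral>x. (X i x / max T (X i x)) powr p \<partial>M) \<le> \<bar>b\<bar> / T"
        by (simp add: prob_space)
    qed
    also have "\<dots> \<le> 1" using T by (simp add: divide_le_eq T_def mult.commute)
    finally have "h T \<le> 1" .
    then obtain \<tau> where "0 \<le> \<tau>" "h \<tau> = 1"
      using IVT2'[of h T 1 0] False T continuous_on_subset[OF cont, of "{0..T}"] by auto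
    then show ?thesis by (intro that[of \<tau>]) (auto simp: h_def)
  qed
qed

lemma lp_norm_nonneg [simp]: "0 \<le> lp_norm J p a"
  by (simp add: lp_norm_def)

lemma lp_norm_scale:
  assumes "p \<noteq> 0"
  shows "lp_norm J p (\<lambda>j. c * a j) = \<bar>c\<bar> * lp_norm J p a"
proof -
  have "lp_norm J p (\<lambda>j. c * a j) = (\<bar>c\<bar> powr p * (\<Sum>j\<in>J. \<bar>a j\<bar> powr p)) powr (1 / p)"
    by (simp add: lp_norm_def abs_mult powr_mult sum_distrib_left)
  then show ?thesis using assms by (simp add: powr_mult sum_nonneg powr_powr lp_norm_def)
qed

lemma lp_norm_powr:
  assumes "p \<noteq> 0"
  shows "lp_norm J p a powr p = (\<Sum>j\<in>J. \<bar>a j\<bar> powr p)"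
  using assms by (simp add: lp_norm_def powr_powr sum_nonneg)

lemma borel_measurable_lp_norm:
  assumes "\<And>j. j \<in> J \<Longrightarrow> (\<lambda>x. a x j) \<in> borel_measurable N"
  shows "(\<lambda>x. lp_norm J p (a x)) \<in> borel_measurable N"
  unfolding lp_norm_def using assms by measurable

text \<open>
  Cutting the norm of \<open>\<Phi>\<close> at level \<open>\<tau>\<close> splits \<open>\<Phi>\<close> into a part \<open>H\<close>, of norm
  \<open>min \<tau> (X i x)\<close>, and the excess \<open>G\<close>. By the choice of the level, the \<open>L\<^sup>p\<close> norm of \<open>H\<close> is
  exactly \<open>\<tau>\<close>, and it can be rewritten as a sum of integrals. The right side is the pairing of
  \<open>\<Phi>\<close> with its norming functional.
\<close>

lemma L1_plus_Lp_norm_le: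
  fixes \<Phi> :: "'i \<Rightarrow> 'a \<Rightarrow> 'j \<Rightarrow> real" and J :: "'j set" and p \<tau> :: real
  defines "X \<equiv> \<lambda>i x. lp_norm J p (\<Phi> i x)"
  assumes "finite_measure M" and fin: "finite (space M)" and p: "1 \<le> p"
    and sub: "\<And>i. i \<in> I \<Longrightarrow> subalgebra M (\<F> i)"
    and \<Phi>: "lp_measurable I J \<F> \<Phi>"
    and \<tau>: "0 \<le> \<tau>"
    and level: "\<tau> = 0 \<or> (\<Sum>i\<in>I. \<integral>x. (X i x / max \<tau> (X i x)) powr p \<partial>M) = 1"
  shows "L1_plus_Lp_norm M I J \<F> p \<Phi>
           \<le> (\<Sum>i\<in>I. \<integral>x. X i x * (X i x / max \<tau> (X i x)) powr (p - 1) \<partial>M)"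
proof -
  interpret finite_measure M by fact
  note int = finite_space_integrable[OF finite_measure_axioms fin]
  define c where "c = (\<lambda>i x. 1 / max \<tau> (X i x))"
  define H where "H = (\<lambda>i x j. \<tau> * c i x * \<Phi> i x j)"
  define G where "G = (\<lambda>i x j. (1 - \<tau> * c i x) * \<Phi> i x j)"
  have \<Phi>m: "(\<lambda>x. \<Phi> i x j) \<in> borel_measurable (\<F> i)" if "i \<in> I" "j \<in> J" for i j
    using \<Phi> that by (auto simp: lp_measurable_def)
  have Xm: "X i \<in> borel_measurable (\<F> i)" if "i \<in> I" for i
    unfolding X_def using \<Phi>m[OF that] by (intro borel_measurable_lp_norm) auto
  have XM: "X i \<in> borel_measurable M" if "i \<in> I" for i
    using measurable_from_subalg[OF sub[OF that] Xm[OF that]] .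
  have cm: "c i \<in> borel_measurable (\<F> i)" if "i \<in> I" for i
    unfolding c_def using Xm[OF that] by measurable
  have cM: "c i \<in> borel_measurable M" if "i \<in> I" for i
    using measurable_from_subalg[OF sub[OF that] cm[OF that]] .
  have X0: "0 \<le> X i x" for i x by (simp add: X_def)
  have c0: "0 \<le> c i x" for i x using \<tau> by (simp add: c_def)
  have lc: "\<tau> * c i x \<le> 1" for i x using \<tau> by (auto simp: c_def divide_le_eq_1)
  have nG: "lp_norm J p (G i x) = (1 - \<tau> * c i x) * X i x" for i x
    unfolding G_def X_def using p lc[of i x] by (subst lp_norm_scale) auto
  have nH: "lp_norm J p (H i x) = \<tau> * (c i x * X i x)" for i x
    unfolding H_def X_def using p \<tau> c0[of i x] by (subst lp_norm_scale) auto
  have cX: "X i x / max \<tau> (X i x) = c i x * X i x" for i x by (simp add: c_def)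
  have Hp: "lp_norm J p (H i x) powr p = \<tau> powr p * (c i x * X i x) powr p" for i x
    unfolding nH using \<tau> c0 X0 by (simp add: powr_mult)
  have dec: "L1_plus_Lp_norm M I J \<F> p \<Phi>
      \<le> (\<Sum>i\<in>I. \<integral>x. lp_norm J p (G i x) \<partial>M) + (\<Sum>i\<in>I. \<integral>x. lp_norm J p (H i x) powr p \<partial>M) powr (1 / p)"
    unfolding L1_plus_Lp_norm_def
  proof (rule cInf_lower)
    show "bdd_below {(\<Sum>i\<in>I. \<integral>x. lp_norm J p (G i x) \<partial>M)
            + (\<Sum>i\<in>I. \<integral>x. lp_norm J p (H i x) powr p \<partial>M) powr (1 / p) | G H.
          lp_measurable I J \<F> G \<and> lp_measurable I J \<F> H \<and>
          (\<forall>i\<in>I. integrable M (\<lambda>x. lp_norm J p (G i x))) \<and>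
          (\<forall>i\<in>I. integrable M (\<lambda>x. lp_norm J p (H i x) powr p)) \<and>
          (\<forall>i\<in>I. \<forall>x\<in>space M. \<forall>j\<in>J. \<Phi> i x j = G i x j + H i x j)}"
      by (rule bdd_belowI[where m = 0]) (auto intro!: add_nonneg_nonneg sum_nonneg)
    have "lp_measurable I J \<F> G" "lp_measurable I J \<F> H"
      unfolding lp_measurable_def G_def H_def using \<Phi>m cm by auto
    moreover have "integrable M (\<lambda>x. lp_norm J p (G i x))"
      "integrable M (\<lambda>x. lp_norm J p (H i x) powr p)" if "i \<in> I" for i
      unfolding nG nH using XM[OF that] cM[OF that] by (intro int; measurable)+
    moreover have "\<Phi> i x j = G i x j + H i x j" for i x j
      by (simp add: G_def H_def algebra_simps)
    ultimately show "(\<Sum>i\<in>I. \<integral>x. lp_norm J p (G i x) \<partial>M)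
            + (\<Sum>i\<in>I. \<integral>x. lp_norm J p (H i x) powr p \<partial>M) powr (1 / p)
        \<in> {(\<Sum>i\<in>I. \<integral>x. lp_norm J p (G i x) \<partial>M)
            + (\<Sum>i\<in>I. \<integral>x. lp_norm J p (H i x) powr p \<partial>M) powr (1 / p) | G H.
          lp_measurable I J \<F> G \<and> lp_measurable I J \<F> H \<and>
          (\<forall>i\<in>I. integrable M (\<lambda>x. lp_norm J p (G i x))) \<and>
          (\<forall>i\<in>I. integrable M (\<lambda>x. lp_norm J p (H i x) powr p)) \<and>
          (\<forall>i\<in>I. \<forall>x\<in>space M. \<forall>j\<in>J. \<Phi> i x j = G i x j + H i x j)}"
      by blast
  qed
  have "(\<Sum>i\<in>I. \<integral>x. lp_norm J p (H i x) powr p \<partial>M) = \<tau> powr p"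
    using level unfolding Hp cX by (auto simp flip: sum_distrib_left)
  then have "(\<Sum>i\<in>I. \<integral>x. lp_norm J p (H i x) powr p \<partial>M) powr (1 / p) = \<tau>"
    using p \<tau> by (simp add: powr_powr)
  also have "\<dots> = (\<Sum>i\<in>I. \<integral>x. \<tau> * (c i x * X i x) powr p \<partial>M)"
    using level unfolding cX by (auto simp flip: sum_distrib_left)
  \<comment> \<open>Merging the two sums makes the remaining identity pointwise. It holds because at each point
      the norm is either below the level, where \<open>\<tau> c = 1\<close>, or above it, where \<open>c X = 1\<close>.\<close>
  finally have "(\<Sum>i\<in>I. \<integral>x. lp_norm J p (G i x) \<partial>M)
        + (\<Sum>i\<in>I. \<integral>x. lp_norm J p (H i x) powr p \<partial>M) powr (1 / p)
      = (\<Sum>i\<in>I. (\<integral>x. (1 - \<tau> * c i x) * X i x \<partial>M) + (\<integral>x. \<tau> * (c i x * X i x) powr p \<partial>M))"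
    by (simp add: nG sum.distrib)
  also have "\<dots> = (\<Sum>i\<in>I. \<integral>x. (1 - \<tau> * c i x) * X i x + \<tau> * (c i x * X i x) powr p \<partial>M)"
    by (intro sum.cong refl Bochner_Integration.integral_add[symmetric] int)
      (use XM cM in measurable)
  also have "\<dots> = (\<Sum>i\<in>I. \<integral>x. X i x * (c i x * X i x) powr (p - 1) \<partial>M)"
  proof (intro sum.cong refl Bochner_Integration.integral_cong)
    fix i x
    show "(1 - \<tau> * c i x) * X i x + \<tau> * (c i x * X i x) powr p = X i x * (c i x * X i x) powr (p - 1)"
    proof (cases "X i x = 0")
      case False
      then have Xpos: "0 < X i x" using X0[of i x] by simp
      show ?thesis
      proof (cases "X i x \<le> \<tau>")
        case True
        then have l: "0 < \<tau>" and c: "c i x = 1 / \<tau>" using Xpos by (auto simp: c_def)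
        have "(X i x / \<tau>) powr p = (X i x / \<tau>) powr (1 + (p - 1))" by simp
        also have "\<dots> = X i x / \<tau> * (X i x / \<tau>) powr (p - 1)"
          using l Xpos by (subst powr_add) auto
        finally show ?thesis using l by (simp add: c)
      next
        case False
        then have "c i x * X i x = 1" using Xpos by (auto simp: c_def)
        then show ?thesis by (simp add: algebra_simps)
      qed
    qed simp
  qed
  finally show ?thesis using dec by (simp add: cX)
qed

section \<open>The inequality with one constant for all weights\<close>

text \<open>
  The weights \<open>u\<close> may be correlated with \<open>f\<close> and with one another in any way. The family \<open>g\<close> stands for \<open>f\<close>, cut down to
  points at which the conditional mean of the weight is at least \<open>\<kappa>\<close>.
\<close>

theorem (in prob_space) weighted_lp_expectation_ge:
  fixes \<F> :: "'i \<Rightarrow> 'a measure" and I :: "'i set" and J :: "'j set"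
    and f u :: "'i \<Rightarrow> 'j \<Rightarrow> 'a \<Rightarrow> real" and g :: "'i \<Rightarrow> 'a \<Rightarrow> 'j \<Rightarrow> real" and p \<kappa> :: real
  assumes fin: "finite (space M)" and finI: "finite I" and finJ: "finite J"
    and sub: "\<And>i. i \<in> I \<Longrightarrow> subalgebra M (\<F> i)"
    and indep: "indep_sets (\<lambda>i. sets (\<F> i)) I"
    and fM: "\<And>i j. i \<in> I \<Longrightarrow> j \<in> J \<Longrightarrow> f i j \<in> borel_measurable M"
    and um: "\<And>i j. i \<in> I \<Longrightarrow> j \<in> J \<Longrightarrow> u i j \<in> borel_measurable M"
    and u01: "\<And>i j x. i \<in> I \<Longrightarrow> j \<in> J \<Longrightarrow> x \<in> space M \<Longrightarrow> 0 \<le> u i j x \<and> u i j x \<le> 1"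
    and g: "lp_measurable I J \<F> g"
    and g_cases: "\<And>i j x. g i x j = 0 \<or> g i x j = f i j x \<and> \<kappa> \<le> real_cond_exp M (\<F> i) (u i j) x"
    and p: "1 \<le> p" and \<kappa>: "0 < \<kappa>"
  shows "\<kappa> powr (2 - 1 / p) * 2 powr (- (1 - 1 / p)) * L1_plus_Lp_norm M I J \<F> p g
           \<le> (\<integral>x. (\<Sum>i\<in>I. \<Sum>j\<in>J. \<bar>u i j x * f i j x\<bar> powr p) powr (1 / p) \<partial>M)"
proof -
  note int = finite_space_integrable[OF finite_measure_axioms fin]
  define \<theta> where "\<theta> = 1 - 1 / p"
  have \<theta>: "0 \<le> \<theta>" using p by (simp add: \<theta>_def)
  have gm: "(\<lambda>x. g i x j) \<in> borel_measurable (\<F> i)" if "i \<in> I" "j \<in> J" for i j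
    using g that by (auto simp: lp_measurable_def)
  define X where "X = (\<lambda>i x. lp_norm J p (g i x))"
  have Xm: "X i \<in> borel_measurable (\<F> i)" if "i \<in> I" for i
    unfolding X_def using gm[OF that] by (intro borel_measurable_lp_norm) auto
  have XM: "X i \<in> borel_measurable M" if "i \<in> I" for i
    using measurable_from_subalg[OF sub[OF that] Xm[OF that]] .
  have X0: "0 \<le> X i x" for i x by (simp add: X_def)
  have Xb: "X i x \<le> (\<Sum>i\<in>I. \<Sum>x\<in>space M. X i x)" if "i \<in> I" "x \<in> space M" for i x
    using member_le_sum[of x "space M" "X i"] that fin X0
      member_le_sum[of i I "\<lambda>i. \<Sum>x\<in>space M. X i x"] finI
    by (force intro: sum_nonneg)
  obtain \<tau> where \<tau>: "0 \<le> \<tau>"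
    and level_le: "(\<Sum>i\<in>I. \<integral>x. (X i x / max \<tau> (X i x)) powr p \<partial>M) \<le> 1"
    and level: "\<tau> = 0 \<or> (\<Sum>i\<in>I. \<integral>x. (X i x / max \<tau> (X i x)) powr p \<partial>M) = 1"
  proof (rule exists_truncation_level[OF prob_space_axioms finI p XM])
    show "0 \<le> X i x \<and> X i x \<le> (\<Sum>i\<in>I. \<Sum>x\<in>space M. X i x)" if "i \<in> I" "x \<in> space M" for i x
      using X0 Xb[OF that] by simp
  qed
  define c where "c = (\<lambda>i x. 1 / max \<tau> (X i x))"
  have c0: "0 \<le> c i x" for i x using \<tau> by (simp add: c_def)
  have cX: "X i x / max \<tau> (X i x) = c i x * X i x" for i x by (simp add: c_def)
  have cX1: "0 \<le> c i x * X i x \<and> c i x * X i x \<le> 1" for i x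
    using \<tau> X0[of i x] by (auto simp: c_def divide_le_eq_1)
  have cm: "c i \<in> borel_measurable (\<F> i)" if "i \<in> I" for i
    unfolding c_def using Xm[OF that] by measurable
  define Z where "Z = (\<lambda>i x. (c i x * X i x) powr p)"
  define S where "S = (\<lambda>x. \<Sum>i\<in>I. Z i x)"
  define d where "d = (\<lambda>i j x. \<bar>g i x j\<bar> * (c i x * \<bar>g i x j\<bar>) powr (p - 1))"
  have Zm: "Z i \<in> borel_measurable (\<F> i)" if "i \<in> I" for i
    unfolding Z_def using Xm[OF that] cm[OF that] by measurable
  have ZM: "Z i \<in> borel_measurable M" if "i \<in> I" for i
    using measurable_from_subalg[OF sub[OF that] Zm[OF that]] .
  have Z01: "0 \<le> Z i x \<and> Z i x \<le> 1" for i x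
    unfolding Z_def using cX1[of i x] p by (auto intro: powr_le1)
  have Z_eq: "Z i x = (\<Sum>j\<in>J. (c i x * \<bar>g i x j\<bar>) powr p)" for i x
    using p c0 X0 by (simp add: Z_def powr_mult X_def lp_norm_powr sum_distrib_left)
  have SM: "S \<in> borel_measurable M" unfolding S_def using ZM by measurable
  have S0: "0 \<le> S x" for x unfolding S_def using Z01 by (auto intro: sum_nonneg)
  have dm: "d i j \<in> borel_measurable (\<F> i)" if "i \<in> I" "j \<in> J" for i j
    unfolding d_def using gm[OF that] cm[OF that(1)] by measurable
  have dM: "d i j \<in> borel_measurable M" if "i \<in> I" "j \<in> J" for i j
    using measurable_from_subalg[OF sub[OF that(1)] dm[OF that]] .
  have d0: "0 \<le> d i j x" for i j x by (simp add: d_def)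

  have Hoelder: "(\<Sum>i\<in>I. \<Sum>j\<in>J. d i j x * u i j x * S x powr (- \<theta>))
        \<le> (\<Sum>i\<in>I. \<Sum>j\<in>J. \<bar>u i j x * f i j x\<bar> powr p) powr (1 / p)"
    (is "_ \<le> ?N") if x: "x \<in> space M" for x
  proof -
    have "(\<Sum>i\<in>I. \<Sum>j\<in>J. d i j x * u i j x)
        \<le> (\<Sum>i\<in>I. \<Sum>j\<in>J. \<bar>u i j x * f i j x\<bar> * (c i x * \<bar>g i x j\<bar>) powr (p - 1))"
    proof (intro sum_mono)
      fix i j assume ij: "i \<in> I" "j \<in> J"
      show "d i j x * u i j x \<le> \<bar>u i j x * f i j x\<bar> * (c i x * \<bar>g i x j\<bar>) powr (p - 1)"
        \<comment> \<open>Where \<open>g\<close> vanishes the left side is \<open>0\<close>; elsewhere \<open>g\<close> equals \<open>f\<close>.\<close>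
        using g_cases[of i x j] u01[OF ij x] by (auto simp: d_def abs_mult)
    qed
    also have "\<dots> \<le> ?N * S x powr \<theta>"
      using Holder_sum_powr[of "I \<times> J" p "\<lambda>(i, j). \<bar>u i j x * f i j x\<bar>" "\<lambda>(i, j). c i x * \<bar>g i x j\<bar>"]
        finI finJ p c0
      by (simp add: sum.cartesian_product split_beta S_def Z_eq \<theta>_def)
    finally have "(\<Sum>i\<in>I. \<Sum>j\<in>J. d i j x * u i j x) * S x powr (- \<theta>) \<le> ?N * S x powr \<theta> * S x powr (- \<theta>)"
      by (rule mult_right_mono) simp
    also have "\<dots> \<le> ?N"
      using S0[of x] by (cases "S x = 0") (simp_all add: powr_minus mult.assoc)
    finally show ?thesis by (simp add: sum_distrib_right)
  qed

  have main: "\<kappa> powr (1 + \<theta>) * 2 powr (- \<theta>) * (\<integral>x. d i j x \<partial>M)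
      \<le> (\<integral>x. d i j x * u i j x * S x powr (- \<theta>) \<partial>M)" if ij: "i \<in> I" "j \<in> J" for i j
  proof (rule weighted_neg_moment_ge[where F = "\<F> i"])
    show "finite_measure_subalgebra M (\<F> i)"
      using sub[OF ij(1)] by unfold_locales
    show "0 < S x \<and> \<kappa> \<le> real_cond_exp M (\<F> i) (u i j) x" if "0 < d i j x" for x
    proof
      have ne: "g i x j \<noteq> 0" "(c i x * \<bar>g i x j\<bar>) powr (p - 1) \<noteq> 0"
        using that by (auto simp: d_def)
      show "\<kappa> \<le> real_cond_exp M (\<F> i) (u i j) x" using g_cases[of i x j] ne by simp
      have "0 < (c i x * \<bar>g i x j\<bar>) powr p" using ne by auto
      also have "\<dots> \<le> Z i x" unfolding Z_eq by (rule member_le_sum) (use ij finJ in auto)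
      also have "\<dots> \<le> S x" unfolding S_def by (rule member_le_sum) (use ij finI Z01 in auto)
      finally show "0 < S x" .
    qed
    show "(\<integral>x. d i j x * S x \<partial>M) \<le> 2 * (\<integral>x. d i j x \<partial>M)"
      unfolding S_def
      by (rule integral_mult_indep_sum_le[OF fin finI sub indep Zm Z01 _ ij(1) dm[OF ij] d0])
        (use level_le in \<open>simp_all add: Z_def cX\<close>)
  qed (use ij d0 dm um u01 SM S0 \<kappa> \<theta> fin in auto)

  let ?L = "L1_plus_Lp_norm M I J \<F> p g"
  let ?E = "\<integral>x. (\<Sum>i\<in>I. \<Sum>j\<in>J. \<bar>u i j x * f i j x\<bar> powr p) powr (1 / p) \<partial>M"
  have "?L \<le> (\<Sum>i\<in>I. \<integral>x. X i x * (X i x / max \<tau> (X i x)) powr (p - 1) \<partial>M)"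
    unfolding X_def
    by (rule L1_plus_Lp_norm_le[OF finite_measure_axioms fin p sub _ \<tau> level[unfolded X_def]])
      (use g in simp_all)
  also have "\<dots> = (\<Sum>i\<in>I. \<integral>x. (\<Sum>j\<in>J. d i j x) \<partial>M)"
  proof (intro sum.cong refl Bochner_Integration.integral_cong)
    fix i x
    have split: "t * (c i x * t) powr (p - 1) = c i x powr (p - 1) * t powr p" if "0 \<le> t" for t
    proof (cases "t = 0")
      case False
      then have "t powr p = t powr (1 + (p - 1))" "0 < t" using that by auto
      then have "t powr p = t * t powr (p - 1)" by (subst (asm) powr_add) auto
      then show ?thesis using c0 by (simp add: powr_mult)
    qed simp
    have "X i x * (X i x / max \<tau> (X i x)) powr (p - 1) = c i x powr (p - 1) * X i x powr p"
      unfolding cX using X0 by (intro split) auto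
    also have "\<dots> = (\<Sum>j\<in>J. c i x powr (p - 1) * \<bar>g i x j\<bar> powr p)"
      using p by (simp add: X_def lp_norm_powr sum_distrib_left)
    also have "\<dots> = (\<Sum>j\<in>J. d i j x)"
      unfolding d_def by (intro sum.cong refl split[symmetric]) auto
    finally show "X i x * (X i x / max \<tau> (X i x)) powr (p - 1) = (\<Sum>j\<in>J. d i j x)" .
  qed
  also have "\<dots> = (\<Sum>i\<in>I. \<Sum>j\<in>J. \<integral>x. d i j x \<partial>M)"
    by (intro sum.cong refl Bochner_Integration.integral_sum int dM)
  finally have L_le: "?L \<le> (\<Sum>i\<in>I. \<Sum>j\<in>J. \<integral>x. d i j x \<partial>M)" .
  have "\<kappa> powr (1 + \<theta>) * 2 powr (- \<theta>) * ?L
      \<le> \<kappa> powr (1 + \<theta>) * 2 powr (- \<theta>) * (\<Sum>i\<in>I. \<Sum>j\<in>J. \<integral>x. d i j x \<partial>M)"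
    by (intro mult_left_mono L_le) auto
  also have "\<dots> \<le> (\<Sum>i\<in>I. \<Sum>j\<in>J. \<integral>x. d i j x * u i j x * S x powr (- \<theta>) \<partial>M)"
    unfolding sum_distrib_left by (intro sum_mono main)
  also have "\<dots> = (\<integral>x. (\<Sum>i\<in>I. \<Sum>j\<in>J. d i j x * u i j x * S x powr (- \<theta>)) \<partial>M)"
    by (subst Bochner_Integration.integral_sum, rule int)
      (use dM um SM in \<open>auto intro!: int sum.cong Bochner_Integration.integral_sum[symmetric]\<close>)
  also have "\<dots> \<le> ?E"
  proof (rule integral_mono[OF int int])
    show "(\<lambda>x. \<Sum>i\<in>I. \<Sum>j\<in>J. d i j x * u i j x * S x powr (- \<theta>)) \<in> borel_measurable M"
      using dM um SM by auto
    show "(\<lambda>x. (\<Sum>i\<in>I. \<Sum>j\<in>J. \<bar>u i j x * f i j x\<bar> powr p) powr (1 / p)) \<in> borel_measurable M"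
      using um fM by measurable
  qed (rule Hoelder)
  finally show ?thesis by (simp add: \<theta>_def)
qed

section \<open>The two constants\<close>

theorem theorem3p5:
  fixes M :: "'a measure" and \<F> :: "'i \<Rightarrow> 'a measure"
    and I :: "'i set" and J :: "'j set"
    and f w :: "'i \<Rightarrow> 'j \<Rightarrow> 'a \<Rightarrow> real" and p \<epsilon> \<kappa> :: real
  assumes "prob_space M" and "finite (space M)"
    and "finite I" and "finite J"
    and "\<And>i. i \<in> I \<Longrightarrow> subalgebra M (\<F> i)"
    and "prob_space.indep_sets M (\<lambda>i. sets (\<F> i)) I"
    and "\<And>i j. i \<in> I \<Longrightarrow> j \<in> J \<Longrightarrow> f i j \<in> borel_measurable (\<F> i)"
    and "\<And>i j. i \<in> I \<Longrightarrow> j \<in> J \<Longrightarrow> w i j \<in> borel_measurable M"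
    and "\<And>i j x. i \<in> I \<Longrightarrow> j \<in> J \<Longrightarrow> x \<in> space M \<Longrightarrow> w i j x \<in> {0..1}"
    and "1 \<le> p" and "0 \<le> \<epsilon>" and "\<epsilon> < \<kappa>" and "\<kappa> \<le> 1"
  shows "(\<integral>x. (\<Sum>i\<in>I. \<Sum>j\<in>J. \<bar>max (w i j x) \<epsilon> * f i j x\<bar> powr p) powr (1 / p) \<partial>M)
           \<ge> \<kappa> powr p * 2 powr (- (1 - 1 / p))
               * L1_plus_Lp_norm M I J \<F> p (truncated_family M \<F> \<epsilon> \<kappa> w f)
       \<and> ((\<forall>i\<in>I. \<forall>j\<in>J. \<forall>x\<in>space M. w i j x \<in> {0, 1}) \<longrightarrow>
         (\<integral>x. (\<Sum>i\<in>I. \<Sum>j\<in>J. \<bar>max (w i j x) \<epsilon> * f i j x\<bar> powr p) powr (1 / p) \<partial>M)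
           \<ge> (\<kappa> - \<epsilon>) powr (2 - 1 / p) * 2 powr (- (1 - 1 / p))
               * L1_plus_Lp_norm M I J \<F> p (truncated_family M \<F> \<epsilon> \<kappa> w f))"
proof -
  interpret prob_space M by fact
  note fin = \<open>finite (space M)\<close> and finI = \<open>finite I\<close> and finJ = \<open>finite J\<close>
    and sub = assms(5) and indep = \<open>indep_sets (\<lambda>i. sets (\<F> i)) I\<close>
    and fm = assms(7) and wm = assms(8) and w01 = assms(9)
    and p = \<open>1 \<le> p\<close> and eps = \<open>0 \<le> \<epsilon>\<close> \<open>\<epsilon> < \<kappa>\<close> and \<kappa>1 = \<open>\<kappa> \<le> 1\<close>
  define \<theta> where "\<theta> = 1 - 1 / p"
  have \<theta>: "0 \<le> \<theta>" using p by (simp add: \<theta>_def)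
  define u where "u = (\<lambda>i j x. max (w i j x) \<epsilon>)"
  have um: "u i j \<in> borel_measurable M" if "i \<in> I" "j \<in> J" for i j
    unfolding u_def using wm[OF that] by measurable
  have u01: "0 \<le> u i j x \<and> u i j x \<le> 1" if "i \<in> I" "j \<in> J" "x \<in> space M" for i j x
    using w01[OF that] eps \<kappa>1 by (auto simp: u_def)
  define g where "g = truncated_family M \<F> \<epsilon> \<kappa> w f"
  have g_cases: "g i x j = 0 \<or> g i x j = f i j x \<and> \<kappa> \<le> real_cond_exp M (\<F> i) (u i j) x" for i j x
    by (auto simp: g_def truncated_family_def u_def indicator_def)
  have gm: "(\<lambda>x. g i x j) \<in> borel_measurable (\<F> i)" if ij: "i \<in> I" "j \<in> J" for i j
  proof -
    have "space (\<F> i) = space M" using sub[OF ij(1)] by (simp add: subalgebra_def)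
    then have "{y \<in> space M. real_cond_exp M (\<F> i) (\<lambda>z. max (w i j z) \<epsilon>) y \<ge> \<kappa>}
        = {y \<in> space (\<F> i). real_cond_exp M (\<F> i) (\<lambda>z. max (w i j z) \<epsilon>) y \<ge> \<kappa>}" by simp
    also have "\<dots> \<in> sets (\<F> i)" by measurable
    finally show ?thesis unfolding g_def truncated_family_def
      using fm[OF ij] by (intro borel_measurable_times borel_measurable_indicator)
  qed
  let ?L = "L1_plus_Lp_norm M I J \<F> p g"
  let ?E = "\<integral>x. (\<Sum>i\<in>I. \<Sum>j\<in>J. \<bar>u i j x * f i j x\<bar> powr p) powr (1 / p) \<partial>M"
  have fM: "f i j \<in> borel_measurable M" if "i \<in> I" "j \<in> J" for i j
    using measurable_from_subalg[OF sub[OF that(1)] fm[OF that]] .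
  have "lp_measurable I J \<F> g" by (simp add: lp_measurable_def gm)
  moreover have exponent: "1 + \<theta> = 2 - 1 / p" and \<kappa>: "0 < \<kappa>" using eps by (simp_all add: \<theta>_def)
  ultimately have bound: "\<kappa> powr (1 + \<theta>) * 2 powr (- \<theta>) * ?L \<le> ?E"
    using weighted_lp_expectation_ge[where f = f and u = u, OF fin finI finJ sub indep fM um u01 _ g_cases p]
    by (simp add: \<theta>_def)
  have le: "C * 2 powr (- \<theta>) * ?L \<le> ?E" if C: "0 \<le> C" "C \<le> \<kappa> powr (1 + \<theta>)" for C
  proof (cases "0 \<le> ?L")
    case True
    then have "C * 2 powr (- \<theta>) * ?L \<le> \<kappa> powr (1 + \<theta>) * 2 powr (- \<theta>) * ?L"
      using C(2) by (intro mult_right_mono) auto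
    then show ?thesis using bound by (rule order_trans)
  next
    case False
    then have "C * 2 powr (- \<theta>) * ?L \<le> 0" using C(1) by (intro mult_nonneg_nonpos) auto
    also have "0 \<le> ?E" by (intro Bochner_Integration.integral_nonneg) auto
    finally show ?thesis .
  qed
  have "\<kappa> powr p \<le> \<kappa> powr (1 + \<theta>)"
  proof (rule powr_mono')
    have "0 \<le> (p - 1)\<^sup>2 / p" using p by simp
    also have "\<dots> = p - (1 + \<theta>)" using p by (simp add: \<theta>_def field_simps power2_eq_square)
    finally show "1 + \<theta> \<le> p" by simp
  qed (use \<kappa> \<kappa>1 in auto)
  note first = le[OF powr_ge_zero this]
  have "(\<kappa> - \<epsilon>) powr (1 + \<theta>) \<le> \<kappa> powr (1 + \<theta>)"
    using eps \<theta> by (intro powr_mono2) auto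
  note second = le[OF powr_ge_zero this]
  show ?thesis using first second exponent by (simp add: \<theta>_def u_def g_def)
qed

end
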